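(* Let a vector $\mathbf x\in\mathbb R^{J_1\cdots J_N}$ and a matrix $\mathbf A\in\mathbb R^{I_1\cdots I_N\times J_1\cdots J_N}$ be represented by vector TT and matrix TT decompositions $$\mathbf x=\widetilde{\mathbf X}^{(1)}\,|\!\otimes\!|\,\cdots\,|\!\otimes\!|\,\widetilde{\mathbf X}^{(N)},\qquad \mathbf A=\widetilde{\mathbf A}^{(1)}\,|\!\otimes\!|\,\cdots\,|\!\otimes\!|\,\widetilde{\mathbf A}^{(N)},$$ with block matrices $\widetilde{\mathbf X}^{(m)}=[\mathbf x^{(m)}_{r_{m-1},r_m}]\in\mathbb R^{R_{m-1}J_m\times R_m}$ having blocks $\mathbf x^{(m)}_{r_{m-1},r_m}\in\mathbb R^{J_m}$, and $\widetilde{\mathbf A}^{(m)}=[\mathbf A^{(m)}_{r^A_{m-1},r^A_m}]\in\mathbb R^{R^A_{m-1}I_m\times R^A_mJ_m}$ having blocks in $\mathbb R^{I_m\times J_m}$, where $R_0=R_N=R^A_0=R^A_N=1$. For a fixed $n\in\{1,\ldots,N\}$, let $\mathbf X^{\neq n}\in\mathbb R^{J_1\cdots J_N\times R_{n-1}J_nR_n}$ be the $n$th frame matrix of this TT decomposition of $\mathbf x$ and $$\widetilde{\mathbf A}_n=\mathbf A\mathbf X^{\neq n}\in\mathbb R^{I_1I_2\cdots I_N\times R_{n-1}J_nR_n}.$$ Then for any vector $\mathbf w^{(n)}\in\mathbb R^{R_{n-1}J_nR_n}$, $$\widetilde{\mathbf A}_n\mathbf w^{(n)}=\widetilde{\mathbf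 Z}^{(1)}\,|\!\otimes\!|\,\cdots\,|\!\otimes\!|\,\widetilde{\mathbf Z}^{(N)}\in\mathbb R^{I_1I_2\cdots I_N},$$ with block matrices $$\widetilde{\mathbf Z}^{(m)}=\widetilde{\mathbf A}^{(m)}\times^1\widetilde{\mathbf X}^{(m)}\in\mathbb R^{R^A_{m-1}R_{m-1}I_m\times R^A_mR_m},\quad m\in\{1,\ldots,N\}\setminus\{n\},$$ $$\widetilde{\mathbf Z}^{(n)}=\widetilde{\mathbf A}^{(n)}\times^1\widetilde{\mathbf W}^{(n)}\in\mathbb R^{R^A_{n-1}R_{n-1}I_n\times R^A_nR_n},$$ where $\underline{\mathbf W}^{(n)}\in\mathbb R^{R_{n-1}\times J_n\times R_n}$ is the 3rd-order tensor with $\mathbf w^{(n)}=\mathrm{vec}(\underline{\mathbf W}^{(n)})$ and $\widetilde{\mathbf W}^{(n)}=[\underline{\mathbf W}^{(n)}(r_{n-1},:,r_n)]\in\mathbb R^{R_{n-1}J_n\times R_n}$ is the block matrix partitioned with the fiber vectors $\underline{\mathbf W}^{(n)}(r_{n-1},:,r_n)\in\mathbb R^{J_n}$.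
   Context: Multi-index: $\overline{i_1i_2\cdots i_N}=i_N+(i_{N-1}-1)I_N+\cdots+(i_1-1)I_2I_3\cdots I_N$ (last index fastest). For a real tensor $\underline{\mathbf X}\in\mathbb R^{I_1\times\cdots\times I_N}$: $(\mathrm{vec}(\underline{\mathbf X}))_{\overline{i_1\cdots i_N}}=(\mathbf X_{(n)})_{i_n,\overline{i_1\cdots i_{n-1}i_{n+1}\cdots i_N}}=\underline{\mathbf X}(i_1,\ldots,i_N)$ defines the vectorization and the mode-$n$ matricization $\mathbf X_{(n)}$. Entries of vectors and matrices of sizes such as $J_1\cdots J_N$ are indexed by the multi-indices. $\otimes$ is the usual Kronecker product. Strong Kronecker product: for block matrices $\mathbf B=[\mathbf B_{r_1,r_2}]$ with $R_1\times R_2$ blocks of size $I_1\times J_1$ and $\mathbf C=[\mathbf C_{r_2,r_3}]$ with $R_2\times R_3$ blocks of size $I_2\times J_2$, $\mathbf B\,|\!\otimes\!|\,\mathbf C$ is the block matrix with $R_1\times R_3$ blocks $\sum_{r_2=1}^{R_2}\mathbf B_{r_1,r_2}\otimes\mathbf C_{r_2,r_3}$ of size $I_1I_2\times J_1J_2$. It is associative. (Vectors are blocks with one column.) Contracted product of block matrices: for block matrices with blocks $\mathbf B_{r_1,r_2}$ ($R_1\times R_2$ of them) and $\mathbf C_{s_1,s_2}$ ($S_1\times S_2$ of them) of compatible sizes, $[\mathbf B_{r_1,r_2}]\times^1[\mathbf C_{s_1,s_2}]$ is the block matrix with $R_1S_1\times R_2S_2$ blocks whose block at position $(\overline{r_1s_1},\overline{r_2s_2})$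 is the product $\mathbf B_{r_1,r_2}\mathbf C_{s_1,s_2}$ (matrix-vector product if the latter is a vector). In particular the block of $\widetilde{\mathbf A}^{(m)}\times^1\widetilde{\mathbf X}^{(m)}$ at $(\overline{r^A_{m-1}r_{m-1}},\overline{r^A_mr_m})$ is $\mathbf A^{(m)}_{r^A_{m-1},r^A_m}\mathbf x^{(m)}_{r_{m-1},r_m}\in\mathbb R^{I_m}$. Frame matrix: the TT-cores of $\mathbf x$ are the tensors $\underline{\mathbf X}^{(m)}\in\mathbb R^{R_{m-1}\times J_m\times R_m}$ with fibers $\underline{\mathbf X}^{(m)}(r_{m-1},:,r_m)=\mathbf x^{(m)}_{r_{m-1},r_m}$. The contracted product of tensors $\underline{\mathbf U}\times^1\underline{\mathbf V}$ sums over the last mode of $\underline{\mathbf U}$ and first mode of $\underline{\mathbf V}$. Dropping singleton boundary modes, $\underline{\mathbf X}^{<n}=\underline{\mathbf X}^{(1)}\times^1\cdots\times^1\underline{\mathbf X}^{(n-1)}\in\mathbb R^{J_1\times\cdots\times J_{n-1}\times R_{n-1}}$, $\underline{\mathbf X}^{>n}=\underline{\mathbf X}^{(n+1)}\times^1\cdots\times^1\underline{\mathbf X}^{(N)}\in\mathbb R^{R_n\times J_{n+1}\times\cdots\times J_N}$, $\underline{\mathbf X}^{<1}=\underline{\mathbf X}^{>N}=1$, and $$\mathbf X^{\neq n}=\left(\mathbf X^{<n}_{(n)}\right)^\top\otimes\mathbf I_{J_n}\otimes\left(\mathbf X^{>n}_{(1)}\right)^\top,$$ where $\mathbf X^{<n}_{(n)}\in\mathbb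 R^{R_{n-1}\times J_1\cdots J_{n-1}}$ and $\mathbf X^{>n}_{(1)}\in\mathbb R^{R_n\times J_{n+1}\cdots J_N}$ are matricizations along the last and first mode respectively. *)

theory Defs
  imports "Jordan_Normal_Form.Matrix"
begin

text \<open>
  All indices are 0-based, so \<^term>\<open>multi_index [d1, d2, d3] [i1, i2, i3]\<close> below is
  \<open>i1 * d2 * d3 + i2 * d3 + i3\<close> (last index fastest); it is the 1-based multi-index shifted by one.
\<close>

fun multi_index :: "nat list \<Rightarrow> nat list \<Rightarrow> nat" where
  "multi_index (d # ds) (i # js) = i * prod_list ds + multi_index ds js"
| "multi_index _ _ = 0"

definition index_set :: "nat list \<Rightarrow> nat list set" where
  "index_set ds = {js. list_all2 (<) js ds}"

definition multi_index_inv :: "nat list \<Rightarrow> nat \<Rightarrow> nat list" where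
  "multi_index_inv ds = the_inv_into (index_set ds) (multi_index ds)"

lemma multi_index_less: "js \<in> index_set ds \<Longrightarrow> multi_index ds js < prod_list ds"
proof (induction ds js rule: multi_index.induct)
  case (1 d ds i js)
  then have i: "i < d" and m: "multi_index ds js < prod_list ds"
    by (auto simp: index_set_def)
  have "i * prod_list ds + multi_index ds js < Suc i * prod_list ds"
    using m by simp
  also have "\<dots> \<le> d * prod_list ds"
    using i by (intro mult_le_mono1) simp
  finally show ?case by simp
qed (auto simp: index_set_def)

lemma inj_on_multi_index: "inj_on (multi_index ds) (index_set ds)"
proof (induction ds)
  case Nil
  then show ?case by (auto simp: index_set_def inj_on_def)
next
  case (Cons d ds)
  show ?case
  proof (rule inj_onI)
    fix xs ys
    assume xs: "xs \<in> index_set (d # ds)" and ys: "ys \<in> index_set (d # ds)"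
      and eq: "multi_index (d # ds) xs = multi_index (d # ds) ys"
    obtain i is' where x: "xs = i # is'" "is' \<in> index_set ds"
      using xs by (auto simp: index_set_def list_all2_Cons2)
    obtain j js where y: "ys = j # js" "js \<in> index_set ds"
      using ys by (auto simp: index_set_def list_all2_Cons2)
    note lx = multi_index_less[OF x(2)] and ly = multi_index_less[OF y(2)]
    have e: "i * prod_list ds + multi_index ds is' = j * prod_list ds + multi_index ds js"
      using eq x(1) y(1) by simp
    have "i = j"
      using arg_cong[OF e, of "\<lambda>k. k div prod_list ds"] lx ly by simp
    moreover from this have "is' = js"
      using e Cons.IH x(2) y(2) by (auto dest: inj_onD)
    ultimately show "xs = ys"
      using x(1) y(1) by simp
  qed
qed

lemma bij_betw_multi_index: "bij_betw (multi_index ds) (index_set ds) {..<prod_list ds}"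
proof -
  have "k \<in> multi_index ds ` index_set ds" if "k < prod_list ds" for k
    using that
  proof (induction ds arbitrary: k)
    case Nil
    then show ?case by (auto simp: index_set_def)
  next
    case (Cons d ds)
    have pos: "prod_list ds > 0"
      using Cons.prems by (cases "prod_list ds") auto
    obtain js where js: "js \<in> index_set ds" "k mod prod_list ds = multi_index ds js"
      using Cons.IH[of "k mod prod_list ds"] pos by auto
    have "k div prod_list ds < d"
      using Cons.prems by (simp add: less_mult_imp_div_less)
    then have "k div prod_list ds # js \<in> index_set (d # ds)"
      using js(1) by (simp add: index_set_def)
    moreover have "multi_index (d # ds) (k div prod_list ds # js) = k"
      using js(2)[symmetric] by simp
    ultimately show ?case by (metis image_eqI)
  qed
  then show ?thesis
    using inj_on_multi_index multi_index_less by (auto simp: bij_betw_def)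
qed

text \<open>Entries of a tensor at lists outside \<^term>\<open>index_set (dims T)\<close> are irrelevant.\<close>

datatype tensor = Tensor (dims: "nat list") (entry: "nat list \<Rightarrow> real")

definition vec_tensor :: "tensor \<Rightarrow> real vec" where
  "vec_tensor T = vec (prod_list (dims T)) (\<lambda>k. entry T (multi_index_inv (dims T) k))"

text \<open>Matricization along the \<open>n\<close>-th mode, modes being counted from 1.\<close>

definition matricize :: "nat \<Rightarrow> tensor \<Rightarrow> real mat" where
  "matricize n T =
    (let others = take (n - 1) (dims T) @ drop n (dims T)
     in mat (dims T ! (n - 1)) (prod_list others)
          (\<lambda>(i, k). let js = multi_index_inv others k
                    in entry T (take (n - 1) js @ [i] @ drop (n - 1) js)))"

lemma vec_tensor_index:
  assumes "js \<in> index_set (dims T)"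
  shows "vec_tensor T $ multi_index (dims T) js = entry T js"
  using assms multi_index_less[OF assms]
  by (simp add: vec_tensor_def multi_index_inv_def the_inv_into_f_f[OF inj_on_multi_index])

lemma ex_vec_tensor:
  assumes "w \<in> carrier_vec (prod_list ds)"
  shows "\<exists>T. dims T = ds \<and> vec_tensor T = w"
proof (intro exI conjI)
  show "vec_tensor (Tensor ds (\<lambda>js. w $ multi_index ds js)) = w"
    using assms f_the_inv_into_f_bij_betw[OF bij_betw_multi_index[of ds]]
    by (intro eq_vecI) (auto simp: vec_tensor_def multi_index_inv_def)
qed simp

definition tensor_contract :: "tensor \<Rightarrow> tensor \<Rightarrow> tensor" where
  "tensor_contract U V =
    (let p = length (dims U) - 1
     in Tensor (butlast (dims U) @ tl (dims V))
          (\<lambda>js. \<Sum>r<last (dims U). entry U (take p js @ [r]) * entry V (r # drop p js)))"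

definition drop_first_mode :: "tensor \<Rightarrow> tensor" where
  "drop_first_mode T = Tensor (tl (dims T)) (\<lambda>js. entry T (0 # js))"

definition drop_last_mode :: "tensor \<Rightarrow> tensor" where
  "drop_last_mode T = Tensor (butlast (dims T)) (\<lambda>js. entry T (js @ [0]))"

text \<open>
  The unparenthesized product of a nonempty list under \<open>f\<close>; it is only used for
  associative operations, so the choice of bracketing to the left is immaterial.
\<close>

definition chain :: "('a \<Rightarrow> 'a \<Rightarrow> 'a) \<Rightarrow> 'a list \<Rightarrow> 'a" where
  "chain f xs = foldl f (hd xs) (tl xs)"

definition kron :: "real mat \<Rightarrow> real mat \<Rightarrow> real mat" where
  "kron A B = mat (dim_row A * dim_row B) (dim_col A * dim_col B)
    (\<lambda>(i, j). A $$ (i div dim_row B, j div dim_col B) * B $$ (i mod dim_row B, j mod dim_col B))"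

text \<open>
  A block matrix is a matrix of equally sized blocks. Vector blocks are one-column matrices.
  The block size is read off the block at \<open>(0, 0)\<close>, so there must be at least one block.
\<close>

type_synonym block_matrix = "real mat mat"

definition block_carrier :: "nat \<Rightarrow> nat \<Rightarrow> nat \<Rightarrow> nat \<Rightarrow> block_matrix set" where
  "block_carrier R S I J =
    {B \<in> carrier_mat R S. \<forall>r<R. \<forall>s<S. B $$ (r, s) \<in> carrier_mat I J}"

definition block_rows :: "block_matrix \<Rightarrow> nat" where
  "block_rows B = dim_row (B $$ (0, 0))"

definition block_cols :: "block_matrix \<Rightarrow> nat" where
  "block_cols B = dim_col (B $$ (0, 0))"

definition unblock :: "block_matrix \<Rightarrow> real mat" where
  "unblock B = mat (dim_row B * block_rows B) (dim_col B * block_cols B)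
    (\<lambda>(i, j). B $$ (i div block_rows B, j div block_cols B)
                $$ (i mod block_rows B, j mod block_cols B))"

definition strong_kron :: "block_matrix \<Rightarrow> block_matrix \<Rightarrow> block_matrix" where
  "strong_kron B C = mat (dim_row B) (dim_col C)
    (\<lambda>(r, s). mat (block_rows B * block_rows C) (block_cols B * block_cols C)
      (\<lambda>(i, j). \<Sum>t<dim_col B. kron (B $$ (r, t)) (C $$ (t, s)) $$ (i, j)))"

definition contracted_product :: "block_matrix \<Rightarrow> block_matrix \<Rightarrow> block_matrix" where
  "contracted_product B C = mat (dim_row B * dim_row C) (dim_col B * dim_col C)
    (\<lambda>(p, q). B $$ (p div dim_row C, q div dim_col C) * C $$ (p mod dim_row C, q mod dim_col C))"

text \<open>The product \<open>B 1 |\<otimes>| \<dots> |\<otimes>| B N\<close>, as the underlying unpartitioned matrix.\<close>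

definition tt_product :: "nat \<Rightarrow> (nat \<Rightarrow> block_matrix) \<Rightarrow> real mat" where
  "tt_product N B = unblock (chain strong_kron (map B [1..<Suc N]))"

definition col_mat :: "real vec \<Rightarrow> real mat" where
  "col_mat v = mat_of_cols (dim_vec v) [v]"

definition tt_core :: "block_matrix \<Rightarrow> tensor" where
  "tt_core X = Tensor [dim_row X, block_rows X, dim_col X]
    (\<lambda>js. X $$ (js ! 0, js ! 2) $$ (js ! 1, 0))"

definition fiber_blocks :: "tensor \<Rightarrow> block_matrix" where
  "fiber_blocks W = mat (dims W ! 0) (dims W ! 2)
    (\<lambda>(r, s). col_mat (vec (dims W ! 1) (\<lambda>j. entry W [r, j, s])))"

text \<open>
  The interface tensors to the left and right of mode \<open>n\<close>. The boundary scalars 1 (for \<open>n = 1\<close>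
  and \<open>n = N\<close>) keep the singleton mode of size \<open>R\<^sub>0 = R\<^sub>N = 1\<close>, so that their matricizations are
  the 1-by-1 matrix with entry 1.
\<close>

definition tt_left :: "(nat \<Rightarrow> block_matrix) \<Rightarrow> nat \<Rightarrow> tensor" where
  "tt_left X n =
    (if n = 1 then Tensor [1] (\<lambda>_. 1)
     else drop_first_mode (chain tensor_contract (map (\<lambda>m. tt_core (X m)) [1..<n])))"

definition tt_right :: "nat \<Rightarrow> (nat \<Rightarrow> block_matrix) \<Rightarrow> nat \<Rightarrow> tensor" where
  "tt_right N X n =
    (if n = N then Tensor [1] (\<lambda>_. 1)
     else drop_last_mode (chain tensor_contract (map (\<lambda>m. tt_core (X m)) [Suc n..<Suc N])))"

definition frame_matrix :: "nat \<Rightarrow> (nat \<Rightarrow> block_matrix) \<Rightarrow> nat \<Rightarrow> real mat" where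
  "frame_matrix N X n =
    kron (kron (transpose_mat (matricize n (tt_left X n))) (1\<^sub>m (block_rows (X n))))
      (transpose_mat (matricize 1 (tt_right N X n)))"

end

(* The strong Kronecker product is associative and satisfies the mixed product rule
   (B |x| B') x^1 (C |x| C') = (B x^1 C) |x| (B' x^1 C'), so the TT product of the blockwise
   contracted products of A and Y is the matrix product of the TT products of A and Y. It remains
   to see that X^{\<noteq>n} w is the TT product of the cores of x with the n-th one replaced by W:
   regroup the chain as (cores < n) |x| W |x| (cores > n). The two outer factors are, up to
   transposition, the matricizations in the frame matrix, and the identity factor of the frame
   matrix selects the fibers of W. *)

theory Submission
  imports Defs
begin

section \<open>Sums over two-level indices and chains\<close>

text \<open>The range below \<open>a * b\<close> falls into \<open>a\<close> consecutive runs of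
  length \<open>b\<close>, on each of which \<open>k div b\<close> is constant. Read in either
  direction, this splits a multi-index into its two digits or merges them.\<close>

lemma sum_lessThan_mult:
  fixes f :: "nat \<Rightarrow> nat \<Rightarrow> 'a::comm_monoid_add"
  shows "(\<Sum>k<a * b. f (k div b) (k mod b)) = (\<Sum>i<a. \<Sum>j<b. f i j)"
proof -
  have "(\<Sum>k\<in>{i * b..<i * b + b}. f (k div b) (k mod b)) = (\<Sum>j<b. f i j)" for i
  proof (rule sum.reindex_bij_witness[of _ "\<lambda>j. i * b + j" "\<lambda>k. k - i * b"])
    fix k
    assume k: "k \<in> {i * b..<i * b + b}"
    then have "k div b = i"
      by (intro div_nat_eqI) (simp_all add: mult.commute)
    then show "f i (k - i * b) = f (k div b) (k mod b)"
      using minus_div_mult_eq_mod[of k b] by simp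
  qed auto
  then show ?thesis
    by (subst sum.nat_group[symmetric]) (rule sum.cong[OF refl])
qed

lemma chain_singleton: "chain f [x] = x"
  by (simp add: chain_def)

lemma chain_snoc: "xs \<noteq> [] \<Longrightarrow> chain f (xs @ [y]) = f (chain f xs) y"
  by (simp add: chain_def)

lemma chain_upt_Suc:
  assumes "a < b"
  shows "chain f (map B [Suc a..<Suc (Suc b)]) = f (chain f (map B [Suc a..<Suc b])) (B (Suc b))"
  using assms chain_snoc[of "map B [Suc a..<Suc b]" f "B (Suc b)"] by simp

lemma prod_list_map_upt: "prod_list (map J [Suc a..<Suc b]) = (\<Prod>m=Suc a..b. J m)"
  by (metis atLeastLessThanSuc_atLeastAtMost distinct_upt prod.distinct_set_conv_list set_upt)

section \<open>Block matrices and associativity of the strong Kronecker product\<close>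

lemma block_carrierD:
  assumes "B \<in> block_carrier R S I J"
  shows "dim_row B = R" "dim_col B = S"
    and "r < R \<Longrightarrow> s < S \<Longrightarrow> B $$ (r, s) \<in> carrier_mat I J"
    and "0 < R \<Longrightarrow> 0 < S \<Longrightarrow> block_rows B = I" "0 < R \<Longrightarrow> 0 < S \<Longrightarrow> block_cols B = J"
  using assms by (auto simp: block_carrier_def block_rows_def block_cols_def)

lemma block_matrix_eqI:
  assumes B: "B \<in> block_carrier R S I J" and C: "C \<in> block_carrier R S I J"
    and eq: "\<And>r s i j. r < R \<Longrightarrow> s < S \<Longrightarrow> i < I \<Longrightarrow> j < J \<Longrightarrow> B $$ (r, s) $$ (i, j) = C $$ (r, s) $$ (i, j)"
  shows "B = C"
proof (rule eq_matI)
  fix r s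
  assume "r < dim_row C" "s < dim_col C"
  then have rs: "r < R" "s < S"
    using block_carrierD[OF C] by auto
  show "B $$ (r, s) = C $$ (r, s)"
    using block_carrierD(3)[OF B rs] block_carrierD(3)[OF C rs] eq[OF rs] by (intro eq_matI) auto
qed (use block_carrierD[OF B] block_carrierD[OF C] in auto)

text \<open>With boundary ranks 1 a full TT product has a single block, so forgetting the partition
  merely extracts it.\<close>

lemma unblock_single:
  assumes "B \<in> block_carrier 1 1 I J"
  shows "unblock B = B $$ (0, 0)"
proof -
  have "B $$ (0, 0) \<in> carrier_mat I J"
    using block_carrierD(3)[OF assms] by simp
  then show ?thesis
    using block_carrierD(1,2,4,5)[OF assms] by (intro eq_matI) (simp_all add: unblock_def)
qed

text \<open>Block sizes are read off the block at \<open>(0, 0)\<close> of each factor. Positive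
  ranks guarantee that this block exists and has the declared size.\<close>

lemma
  assumes B: "B \<in> block_carrier R S I J" and C: "C \<in> block_carrier S T K L"
    and pos: "0 < R" "0 < S" "0 < T"
  shows strong_kron_carrier: "strong_kron B C \<in> block_carrier R T (I * K) (J * L)"
    and strong_kron_index: "\<And>r t i j. r < R \<Longrightarrow> t < T \<Longrightarrow> i < I * K \<Longrightarrow> j < J * L \<Longrightarrow>
      strong_kron B C $$ (r, t) $$ (i, j) =
        (\<Sum>s<S. B $$ (r, s) $$ (i div K, j div L) * C $$ (s, t) $$ (i mod K, j mod L))"
proof -
  note b = block_carrierD[OF B] and c = block_carrierD[OF C]
  show "strong_kron B C \<in> block_carrier R T (I * K) (J * L)"
    using pos by (auto simp: block_carrier_def strong_kron_def b c)
  fix r t i j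
  assume rt: "r < R" "t < T" and ij: "i < I * K" "j < J * L"
  have "kron (B $$ (r, s)) (C $$ (s, t)) $$ (i, j) =
      B $$ (r, s) $$ (i div K, j div L) * C $$ (s, t) $$ (i mod K, j mod L)" if "s < S" for s
    using b(3)[OF rt(1) that] c(3)[OF that rt(2)] ij by (auto simp: kron_def)
  then show "strong_kron B C $$ (r, t) $$ (i, j) =
        (\<Sum>s<S. B $$ (r, s) $$ (i div K, j div L) * C $$ (s, t) $$ (i mod K, j mod L))"
    using rt ij pos by (auto simp: strong_kron_def b c intro!: sum.cong)
qed

text \<open>The middle digit of a three-level index does not depend on which outer digit is stripped
  first. For \<open>b = 0\<close> both sides are 0.\<close>

lemma mod_mult_div_nat: "(i :: nat) mod (a * b) div b = i div b mod a"
  by (cases "b = 0") (simp_all add: mult.commute[of a] mod_mult2_eq)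

text \<open>Either bracketing decomposes \<open>i\<close> and \<open>j\<close> into the same three
  digits, one for each factor. What remains is to exchange the sums over the two inner block indices
  \<open>s\<close> and \<open>t\<close>.\<close>

lemma strong_kron_assoc:
  assumes B: "B \<in> block_carrier R S I J" and C: "C \<in> block_carrier S T K L"
    and D: "D \<in> block_carrier T U P Q"
    and pos: "0 < R" "0 < S" "0 < T" "0 < U"
  shows "strong_kron (strong_kron B C) D = strong_kron B (strong_kron C D)"
proof -
  note BC = strong_kron_carrier[OF B C pos(1-3)] and CD = strong_kron_carrier[OF C D pos(2-4)]
  have l: "strong_kron (strong_kron B C) D \<in> block_carrier R U (I * (K * P)) (J * (L * Q))"
    using strong_kron_carrier[OF BC D] pos by (simp add: mult.assoc)
  show ?thesis
  proof (rule block_matrix_eqI[OF l strong_kron_carrier[OF B CD pos(1,2,4)]])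
    fix r u i j
    assume rs: "r < R" "u < U" and i: "i < I * (K * P)" and j: "j < J * (L * Q)"
    have i': "i div P < I * K" "i mod (K * P) < K * P" and j': "j div Q < J * L" "j mod (L * Q) < L * Q"
      using i j by (auto simp: less_mult_imp_div_less mult.assoc intro!: mod_less_divisor Nat.gr0I)
    have "strong_kron (strong_kron B C) D $$ (r, u) $$ (i, j) =
        (\<Sum>t<T. (\<Sum>s<S. B $$ (r, s) $$ (i div P div K, j div Q div L) *
          C $$ (s, t) $$ (i div P mod K, j div Q mod L)) * D $$ (t, u) $$ (i mod P, j mod Q))"
      using rs i j i' j' pos
      by (simp add: strong_kron_index[OF BC D] strong_kron_index[OF B C] mult.assoc)
    also have "\<dots> = (\<Sum>s<S. B $$ (r, s) $$ (i div P div K, j div Q div L) *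
        (\<Sum>t<T. C $$ (s, t) $$ (i div P mod K, j div Q mod L) * D $$ (t, u) $$ (i mod P, j mod Q)))"
      unfolding sum_distrib_left sum_distrib_right by (subst sum.swap) (simp add: mult.assoc)
    also have "\<dots> = strong_kron B (strong_kron C D) $$ (r, u) $$ (i, j)"
      using rs i j i' j' pos
      by (simp add: strong_kron_index[OF B CD] strong_kron_index[OF C D] mod_mult_div_nat
          mod_mod_cancel div_mult2_eq[symmetric] mult.commute)
    finally show "strong_kron (strong_kron B C) D $$ (r, u) $$ (i, j) =
        strong_kron B (strong_kron C D) $$ (r, u) $$ (i, j)" .
  qed
qed

text \<open>The value given to an empty product, matching the boundary scalar 1 in
  \<open>tt_left\<close> and \<open>tt_right\<close>.\<close>

definition unit_block :: block_matrix where
  "unit_block = mat 1 1 (\<lambda>_. 1\<^sub>m 1)"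

lemma unit_block_carrier: "unit_block \<in> block_carrier 1 1 1 1"
  by (auto simp: unit_block_def block_carrier_def)

lemma strong_kron_unit_left:
  assumes B: "B \<in> block_carrier 1 S I J" and "0 < S"
  shows "strong_kron unit_block B = B"
proof (rule block_matrix_eqI[OF _ B])
  show "strong_kron unit_block B \<in> block_carrier 1 S I J"
    using strong_kron_carrier[OF unit_block_carrier B] assms by simp
qed (use strong_kron_index[OF unit_block_carrier B] assms in \<open>auto simp: unit_block_def\<close>)

lemma strong_kron_unit_right:
  assumes B: "B \<in> block_carrier R 1 I J" and "0 < R"
  shows "strong_kron B unit_block = B"
proof (rule block_matrix_eqI[OF _ B])
  show "strong_kron B unit_block \<in> block_carrier R 1 I J"
    using strong_kron_carrier[OF B unit_block_carrier] assms by simp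
qed (use strong_kron_index[OF B unit_block_carrier] assms in \<open>auto simp: unit_block_def\<close>)

section \<open>The blockwise contracted product and the mixed product rule\<close>

lemma
  assumes B: "B \<in> block_carrier R S I J" and C: "C \<in> block_carrier P Q J K"
  shows contracted_product_carrier: "contracted_product B C \<in> block_carrier (R * P) (S * Q) I K"
    and contracted_product_index: "\<And>p q i k. p < R * P \<Longrightarrow> q < S * Q \<Longrightarrow> i < I \<Longrightarrow> k < K \<Longrightarrow>
      contracted_product B C $$ (p, q) $$ (i, k) =
        (\<Sum>j<J. B $$ (p div P, q div Q) $$ (i, j) * C $$ (p mod P, q mod Q) $$ (j, k))"
proof -
  note b = block_carrierD[OF B] and c = block_carrierD[OF C]
  have d: "B $$ (p div P, q div Q) \<in> carrier_mat I J" "C $$ (p mod P, q mod Q) \<in> carrier_mat J K"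
    if "p < R * P" "q < S * Q" for p q
  proof -
    have "0 < P" "0 < Q"
      using that by (auto intro: Nat.gr0I)
    then show "B $$ (p div P, q div Q) \<in> carrier_mat I J" "C $$ (p mod P, q mod Q) \<in> carrier_mat J K"
      using that by (auto intro!: b(3) c(3) simp: less_mult_imp_div_less)
  qed
  show "contracted_product B C \<in> block_carrier (R * P) (S * Q) I K"
    unfolding block_carrier_def contracted_product_def b(1,2) c(1,2)
    using mult_carrier_mat[OF d] by simp
  show "contracted_product B C $$ (p, q) $$ (i, k) =
        (\<Sum>j<J. B $$ (p div P, q div Q) $$ (i, j) * C $$ (p mod P, q mod Q) $$ (j, k))"
    if "p < R * P" "q < S * Q" "i < I" "k < K" for p q i k
    using that d[OF that(1,2)]
    by (auto simp: contracted_product_def b(1,2) c(1,2) scalar_prod_def lessThan_atLeast0)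
qed

text \<open>This is the rule for products of Kronecker products, with block indices carried along.
  Both sides equal one fourfold sum: over the digits \<open>a\<close>, \<open>b\<close> of the
  contracted index and over the inner block indices \<open>t\<close>, \<open>u\<close>.\<close>

lemma contracted_product_strong_kron:
  assumes B: "B \<in> block_carrier R S I J" and B': "B' \<in> block_carrier S T I' J'"
    and C: "C \<in> block_carrier P Q J K" and C': "C' \<in> block_carrier Q U J' K'"
    and pos: "0 < R" "0 < S" "0 < T" "0 < P" "0 < Q" "0 < U"
  shows "contracted_product (strong_kron B B') (strong_kron C C') =
    strong_kron (contracted_product B C) (contracted_product B' C')"
proof -
  note BB = strong_kron_carrier[OF B B' pos(1-3)] and CC = strong_kron_carrier[OF C C' pos(4-6)]
  note BC = contracted_product_carrier[OF B C] and BC' = contracted_product_carrier[OF B' C']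
  have pos': "0 < R * P" "0 < S * Q" "0 < T * U"
    using pos by auto
  show ?thesis
  proof (rule block_matrix_eqI[OF contracted_product_carrier[OF BB CC] strong_kron_carrier[OF BC BC' pos']])
    fix p q i k
    assume p: "p < R * P" and q: "q < T * U" and i: "i < I * I'" and k: "k < K * K'"
    have "0 < I'" "0 < K'"
      using i k by (auto intro: Nat.gr0I)
    then have ik: "i div I' < I" "i mod I' < I'" "k div K' < K" "k mod K' < K'"
      using i k by (auto simp: less_mult_imp_div_less)
    have pq: "p div P < R" "p mod P < P" "q div U < T" "q mod U < U"
      using p q pos by (auto simp: less_mult_imp_div_less)
    let ?b = "\<lambda>t a. B $$ (p div P, t) $$ (i div I', a)"
    let ?b' = "\<lambda>t a. B' $$ (t, q div U) $$ (i mod I', a)"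
    let ?c = "\<lambda>u a. C $$ (p mod P, u) $$ (a, k div K')"
    let ?c' = "\<lambda>u a. C' $$ (u, q mod U) $$ (a, k mod K')"
    have "contracted_product (strong_kron B B') (strong_kron C C') $$ (p, q) $$ (i, k) =
        (\<Sum>j<J * J'. (\<Sum>t<S. ?b t (j div J') * ?b' t (j mod J')) *
          (\<Sum>u<Q. ?c u (j div J') * ?c' u (j mod J')))"
      using p q i k pq
      by (auto simp: contracted_product_index[OF BB CC] strong_kron_index[OF B B' pos(1-3)]
          strong_kron_index[OF C C' pos(4-6)] intro!: sum.cong)
    \<comment> \<open>The contracted index runs over \<open>J * J'\<close>; its digits
      \<open>a\<close> and \<open>b\<close> belong to the first and second factor.\<close>
    also have "\<dots> = (\<Sum>a<J. \<Sum>b<J'. (\<Sum>t<S. ?b t a * ?b' t b) * (\<Sum>u<Q. ?c u a * ?c' u b))"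
      by (rule sum_lessThan_mult)
    also have "\<dots> = (\<Sum>a<J. \<Sum>b<J'. \<Sum>t<S. \<Sum>u<Q. (?b t a * ?c u a) * (?b' t b * ?c' u b))"
      by (simp add: sum_product ac_simps)
    \<comment> \<open>Three exchanges bring \<open>t\<close> and \<open>u\<close> to the outside,
      where the summand separates into an \<open>a\<close>-part and a \<open>b\<close>-part.\<close>
    also have "\<dots> = (\<Sum>a<J. \<Sum>t<S. \<Sum>b<J'. \<Sum>u<Q. (?b t a * ?c u a) * (?b' t b * ?c' u b))"
      by (intro sum.cong refl sum.swap)
    also have "\<dots> = (\<Sum>t<S. \<Sum>a<J. \<Sum>u<Q. \<Sum>b<J'. (?b t a * ?c u a) * (?b' t b * ?c' u b))"
      by (subst sum.swap) (intro sum.cong refl sum.swap)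
    also have "\<dots> = (\<Sum>t<S. \<Sum>u<Q. \<Sum>a<J. \<Sum>b<J'. (?b t a * ?c u a) * (?b' t b * ?c' u b))"
      by (intro sum.cong refl sum.swap)
    also have "\<dots> = (\<Sum>t<S. \<Sum>u<Q. (\<Sum>a<J. ?b t a * ?c u a) * (\<Sum>b<J'. ?b' t b * ?c' u b))"
      by (simp add: sum_product)
    \<comment> \<open>The pair \<open>(t, u)\<close> is merged into the inner block index
      \<open>v\<close> of the two contracted products.\<close>
    also have "\<dots> = (\<Sum>v<S * Q. (\<Sum>a<J. ?b (v div Q) a * ?c (v mod Q) a) *
        (\<Sum>b<J'. ?b' (v div Q) b * ?c' (v mod Q) b))"
      by (rule sum_lessThan_mult[symmetric])
    also have "\<dots> = strong_kron (contracted_product B C) (contracted_product B' C') $$ (p, q) $$ (i, k)"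
      using p q i k ik
      by (auto simp: strong_kron_index[OF BC BC' pos'] contracted_product_index[OF B C]
          contracted_product_index[OF B' C'] intro!: sum.cong)
    finally show "contracted_product (strong_kron B B') (strong_kron C C') $$ (p, q) $$ (i, k) =
        strong_kron (contracted_product B C) (contracted_product B' C') $$ (p, q) $$ (i, k)" .
  qed
qed

section \<open>Segments of TT products\<close>

text \<open>
  The product of the factors \<open>B (a+1), \<dots>, B b\<close>. For \<open>a = b\<close> it is the unit of the strong
  Kronecker product only next to a factor with a single block row or column, hence the conditions
  \<open>R a = 1\<close> below; these hold at the two ends of a TT decomposition.
\<close>

definition tt_segment :: "(nat \<Rightarrow> block_matrix) \<Rightarrow> nat \<Rightarrow> nat \<Rightarrow> block_matrix" where
  "tt_segment B a b = (if a = b then unit_block else chain strong_kron (map B [Suc a..<Suc b]))"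

lemma tt_segment_single: "tt_segment B a (Suc a) = B (Suc a)"
  by (simp add: tt_segment_def chain_singleton)

lemma tt_segment_Suc: "a < b \<Longrightarrow> tt_segment B a (Suc b) = strong_kron (tt_segment B a b) (B (Suc b))"
  using chain_upt_Suc[of a b strong_kron B] by (simp add: tt_segment_def)

lemma tt_segment_cong:
  assumes "\<And>m. m \<in> {Suc a..b} \<Longrightarrow> B m = C m"
  shows "tt_segment B a b = tt_segment C a b"
proof -
  have "map B [Suc a..<Suc b] = map C [Suc a..<Suc b]"
    using assms by (intro map_cong) auto
  then show ?thesis
    unfolding tt_segment_def by presburger
qed

text \<open>A common setting for both decompositions: \<open>I m\<close> by \<open>J m\<close>
  blocks for the matrix, and one-column blocks for the vector.\<close>

locale tt_blocks =
  fixes N :: nat and R I J :: "nat \<Rightarrow> nat" and B :: "nat \<Rightarrow> block_matrix"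
  assumes rank_pos: "m \<le> N \<Longrightarrow> 0 < R m"
    and blocks: "m \<in> {1..N} \<Longrightarrow> B m \<in> block_carrier (R (m - 1)) (R m) (I m) (J m)"
begin

lemma blocks_Suc: "m < N \<Longrightarrow> B (Suc m) \<in> block_carrier (R m) (R (Suc m)) (I (Suc m)) (J (Suc m))"
  using blocks[of "Suc m"] by simp

lemma tt_segment_carrier:
  assumes "a \<le> b" "b \<le> N" and unit: "a = b \<Longrightarrow> R a = 1"
  shows "tt_segment B a b \<in> block_carrier (R a) (R b) (\<Prod>m=Suc a..b. I m) (\<Prod>m=Suc a..b. J m)"
proof (cases "a = b")
  case True
  then show ?thesis
    using unit unit_block_carrier by (simp add: tt_segment_def)
next
  case False
  with assms have "Suc a \<le> b" by simp
  then show ?thesis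
    using assms(2)
  \<comment> \<open>The induction starts at one factor, because \<open>chain\<close> is meaningful
    only for nonempty lists.\<close>
  proof (induction b rule: dec_induct)
    case base
    then show ?case
      using blocks[of "Suc a"] by (simp add: tt_segment_single)
  next
    case (step b)
    then have "tt_segment B a b \<in> block_carrier (R a) (R b) (\<Prod>m=Suc a..b. I m) (\<Prod>m=Suc a..b. J m)"
      by simp
    from strong_kron_carrier[OF this blocks_Suc] show ?case
      using step.hyps step.prems rank_pos by (simp add: tt_segment_Suc mult.commute)
  qed
qed

text \<open>The chain brackets to the left, so induction on \<open>c\<close> moves one factor at a
  time across by associativity. An empty piece is absorbed by the unit, since the adjacent rank is
  then 1.\<close>

lemma tt_segment_append:
  assumes "a \<le> b" "b \<le> c" "c \<le> N" and unit: "a = b \<Longrightarrow> R a = 1" "b = c \<Longrightarrow> R c = 1"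
  shows "tt_segment B a c = strong_kron (tt_segment B a b) (tt_segment B b c)"
proof (cases "a = b")
  case True
  show ?thesis
    using strong_kron_unit_left[of "tt_segment B a c"] tt_segment_carrier[of a c] rank_pos[of c]
      assms True by (simp add: tt_segment_def[of B b b])
next
  case ab: False
  show ?thesis
  proof (cases "b = c")
    case True
    then show ?thesis
      using strong_kron_unit_right[of "tt_segment B a c"] tt_segment_carrier[of a c] rank_pos[of a]
        assms ab by (simp add: tt_segment_def[of B c c])
  next
    case False
    with assms have "Suc b \<le> c" by simp
    then show ?thesis
      using assms(3)
    proof (induction c rule: dec_induct)
      case base
      then show ?case
        using assms(1) ab by (simp add: tt_segment_single tt_segment_Suc)
    next
      case (step c)
      then have "tt_segment B a b \<in> block_carrier (R a) (R b) (\<Prod>m=Suc a..b. I m) (\<Prod>m=Suc a..b. J m)"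
        "tt_segment B b c \<in> block_carrier (R b) (R c) (\<Prod>m=Suc b..c. I m) (\<Prod>m=Suc b..c. J m)"
        using tt_segment_carrier[of a b] tt_segment_carrier[of b c] assms(1) ab by simp_all
      from strong_kron_assoc[OF this blocks_Suc] show ?case
        using step assms(1) ab rank_pos by (simp add: tt_segment_Suc)
    qed
  qed
qed

lemma tt_product_eq:
  assumes "1 \<le> N" "R 0 = 1" "R N = 1"
  shows "tt_product N B = tt_segment B 0 N $$ (0, 0)"
proof -
  have "tt_segment B 0 N \<in> block_carrier 1 1 (\<Prod>m=1..N. I m) (\<Prod>m=1..N. J m)"
    using tt_segment_carrier[of 0 N] assms by simp
  from unblock_single[OF this] show ?thesis
    using assms by (simp add: tt_product_def tt_segment_def)
qed

end

text \<open>Appending one factor is one use of the mixed product rule. The two families share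
  \<open>J\<close>: the block widths of \<open>A\<close> are the block heights of
  \<open>X\<close>.\<close>

lemma tt_segment_contracted_product:
  assumes A: "tt_blocks N RA I J A" and X: "tt_blocks N R J K X" and "a < b" "b \<le> N"
  shows "tt_segment (\<lambda>m. contracted_product (A m) (X m)) a b =
    contracted_product (tt_segment A a b) (tt_segment X a b)"
proof -
  interpret A: tt_blocks N RA I J A by fact
  interpret X: tt_blocks N R J K X by fact
  from \<open>a < b\<close> have "Suc a \<le> b" by simp
  then show ?thesis
    using \<open>b \<le> N\<close>
  proof (induction b rule: dec_induct)
    case base
    then show ?case by (simp add: tt_segment_single)
  next
    case (step b)
    then have
      A': "tt_segment A a b \<in> block_carrier (RA a) (RA b) (\<Prod>m=Suc a..b. I m) (\<Prod>m=Suc a..b. J m)" and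
      X': "tt_segment X a b \<in> block_carrier (R a) (R b) (\<Prod>m=Suc a..b. J m) (\<Prod>m=Suc a..b. K m)"
      using A.tt_segment_carrier[of a b] X.tt_segment_carrier[of a b] by simp_all
    from contracted_product_strong_kron[OF A' A.blocks_Suc X' X.blocks_Suc] show ?case
      using step A.rank_pos X.rank_pos by (simp add: tt_segment_Suc)
  qed
qed

lemma tt_product_contracted_product:
  assumes A: "tt_blocks N RA I J A" and X: "tt_blocks N R J K X" and N: "1 \<le> N"
    and boundary: "RA 0 = 1" "RA N = 1" "R 0 = 1" "R N = 1"
  shows "tt_product N (\<lambda>m. contracted_product (A m) (X m)) = tt_product N A * tt_product N X"
proof -
  interpret A: tt_blocks N RA I J A by fact
  interpret X: tt_blocks N R J K X by fact
  interpret AX: tt_blocks N "\<lambda>m. RA m * R m" I K "\<lambda>m. contracted_product (A m) (X m)"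
    using contracted_product_carrier[OF A.blocks X.blocks]
    by unfold_locales (simp_all add: A.rank_pos X.rank_pos)
  have "tt_segment A 0 N \<in> block_carrier 1 1 (\<Prod>m=1..N. I m) (\<Prod>m=1..N. J m)"
    "tt_segment X 0 N \<in> block_carrier 1 1 (\<Prod>m=1..N. J m) (\<Prod>m=1..N. K m)"
    using A.tt_segment_carrier[of 0 N] X.tt_segment_carrier[of 0 N] N boundary by auto
  \<comment> \<open>Each full segment is a single block, so here the contracted product is an
    ordinary matrix product.\<close>
  then have "contracted_product (tt_segment A 0 N) (tt_segment X 0 N) $$ (0, 0) =
      tt_segment A 0 N $$ (0, 0) * tt_segment X 0 N $$ (0, 0)"
    by (simp add: contracted_product_def block_carrierD)
  then show ?thesis
    using N boundary tt_segment_contracted_product[OF A X, of 0 N]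
    by (simp add: AX.tt_product_eq A.tt_product_eq X.tt_product_eq)
qed

section \<open>Multi-indices extended at the end, and vectorized third-order tensors\<close>

lemma index_set_snoc_iff:
  "js \<in> index_set (ds @ [d]) \<longleftrightarrow> (\<exists>js' j. js = js' @ [j] \<and> js' \<in> index_set ds \<and> j < d)"
proof
  assume "js \<in> index_set (ds @ [d])"
  then show "\<exists>js' j. js = js' @ [j] \<and> js' \<in> index_set ds \<and> j < d"
    by (auto simp: index_set_def list_all2_append2 list_all2_Cons2)
qed (auto simp: index_set_def intro!: list_all2_appendI)

lemma index_set_length: "js \<in> index_set ds \<Longrightarrow> length js = length ds"
  by (auto simp: index_set_def dest: list_all2_lengthD)

text \<open>A Horner step: \<open>multi_index\<close> recurses from the front, whereas TT chains
  grow at the back.\<close>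

lemma multi_index_snoc:
  "length js = length ds \<Longrightarrow> multi_index (ds @ [d]) (js @ [j]) = multi_index ds js * d + j"
  by (induction ds js rule: multi_index.induct) (auto simp: algebra_simps)

lemma
  assumes "k < prod_list ds"
  shows multi_index_inv_in_index_set: "multi_index_inv ds k \<in> index_set ds"
    and multi_index_multi_index_inv: "multi_index ds (multi_index_inv ds k) = k"
  using assms bij_betw_multi_index[of ds]
    bij_betw_apply[OF bij_betw_the_inv_into[OF bij_betw_multi_index[of ds]]]
  by (auto simp: multi_index_inv_def f_the_inv_into_f_bij_betw)

lemma fiber_blocks_carrier:
  assumes "dims W = [r, j, s]"
  shows "fiber_blocks W \<in> block_carrier r s j 1"
  by (auto simp: block_carrier_def fiber_blocks_def assms col_mat_def)

text \<open>The digits are written as nested quotients to match those produced by the nested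
  Kronecker products of the frame matrix.\<close>

lemma vec_tensor_index3:
  assumes W: "dims W = [a, b, c]" and k: "k < a * b * c"
  shows "vec_tensor W $ k = entry W [k div c div b, k div c mod b, k mod c]"
proof -
  have "0 < c" "0 < b"
    using k by (auto intro: Nat.gr0I)
  moreover have "k div c < a * b"
    using k by (simp add: less_mult_imp_div_less)
  moreover from this have "k div c div b < a"
    by (simp add: less_mult_imp_div_less)
  ultimately have "[k div c div b, k div c mod b, k mod c] \<in> index_set (dims W)"
    by (simp add: index_set_def W)
  moreover have "k div c div b * (b * c) + (k div c mod b * c + k mod c) = k"
    by (metis add.assoc add_mult_distrib div_mult_mod_eq mult.assoc)
  then have "multi_index (dims W) [k div c div b, k div c mod b, k mod c] = k"
    by (simp add: W)
  ultimately show ?thesis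
    using vec_tensor_index by metis
qed

section \<open>Interface tensors and the entries of the frame matrix\<close>

locale tt_vector = tt_blocks N R J "\<lambda>_. 1" X for N R J X +
  assumes boundary: "R 0 = 1" "R N = 1"
begin

lemma dims_tt_core: "m < N \<Longrightarrow> dims (tt_core (X (Suc m))) = [R m, J (Suc m), R (Suc m)]"
  using block_carrierD[OF blocks_Suc[of m]] rank_pos[of m] rank_pos[of "Suc m"]
  by (simp add: tt_core_def)

lemma tt_vector_segment_carrier:
  assumes "a \<le> b" "b \<le> N" "a = b \<Longrightarrow> R a = 1"
  shows "tt_segment X a b \<in> block_carrier (R a) (R b) (\<Prod>m=Suc a..b. J m) 1"
  using tt_segment_carrier[OF assms] by simp

text \<open>Contracting adjacent cores and multiplying them by the strong Kronecker product both sum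
  over the shared rank. The first and last tensor modes become the block position, and the inner
  modes become the row within a one-column block.\<close>

lemma
  assumes "a < b" "b \<le> N"
  shows dims_chain_tt_core: "dims (chain tensor_contract (map (\<lambda>m. tt_core (X m)) [Suc a..<Suc b])) =
      R a # map J [Suc a..<Suc b] @ [R b]"
    and entry_chain_tt_core: "\<And>r js s. r < R a \<Longrightarrow> js \<in> index_set (map J [Suc a..<Suc b]) \<Longrightarrow> s < R b \<Longrightarrow>
      entry (chain tensor_contract (map (\<lambda>m. tt_core (X m)) [Suc a..<Suc b])) (r # js @ [s]) =
        tt_segment X a b $$ (r, s) $$ (multi_index (map J [Suc a..<Suc b]) js, 0)"
proof -
  let ?T = "\<lambda>b. chain tensor_contract (map (\<lambda>m. tt_core (X m)) [Suc a..<Suc b])"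
  let ?J = "\<lambda>b. map J [Suc a..<Suc b]"
  from \<open>a < b\<close> have "Suc a \<le> b" by simp
  then have "dims (?T b) = R a # ?J b @ [R b] \<and> (\<forall>r js s. r < R a \<longrightarrow> js \<in> index_set (?J b) \<longrightarrow> s < R b \<longrightarrow>
    entry (?T b) (r # js @ [s]) = tt_segment X a b $$ (r, s) $$ (multi_index (?J b) js, 0))"
    using \<open>b \<le> N\<close>
  proof (induction b rule: dec_induct)
    case base
    then show ?case
      using dims_tt_core[of a]
      by (auto simp: chain_singleton tt_segment_single tt_core_def index_set_def list_all2_Cons2)
  next
    case (step b)
    have b: "b < N" "a < b" "b \<le> N"
      using step by auto
    have d: "dims (?T b) = R a # ?J b @ [R b]"
      and e: "\<And>r js s. r < R a \<Longrightarrow> js \<in> index_set (?J b) \<Longrightarrow> s < R b \<Longrightarrow>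
        entry (?T b) (r # js @ [s]) = tt_segment X a b $$ (r, s) $$ (multi_index (?J b) js, 0)"
      using step.IH b by auto
    have T: "?T (Suc b) = tensor_contract (?T b) (tt_core (X (Suc b)))"
      using b by (intro chain_upt_Suc)
    have J: "?J (Suc b) = ?J b @ [J (Suc b)]"
      using b by simp
    note c = tt_vector_segment_carrier[of a b]
    show ?case
    proof (intro conjI allI impI)
      show "dims (?T (Suc b)) = R a # ?J (Suc b) @ [R (Suc b)]"
        unfolding T J using d dims_tt_core[of b] b
        by (simp add: tensor_contract_def Let_def butlast_append del: upt_Suc)
      fix r ks s
      assume r: "r < R a" and "ks \<in> index_set (?J (Suc b))" and s: "s < R (Suc b)"
      then obtain js j where ks: "ks = js @ [j]" "js \<in> index_set (?J b)" "j < J (Suc b)"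
        unfolding J index_set_snoc_iff by auto
      have len: "length js = length (?J b)"
        using ks(2) by (rule index_set_length)
      have m: "multi_index (?J b) js < (\<Prod>m=Suc a..b. J m)"
        using multi_index_less[OF ks(2)] unfolding prod_list_map_upt .
      \<comment> \<open>The extended row index must lie within the larger block before
        \<open>strong_kron_index\<close> can be applied.\<close>
      have "multi_index (?J b) js * J (Suc b) + j < Suc (multi_index (?J b) js) * J (Suc b)"
        using ks(3) by simp
      also have "\<dots> \<le> (\<Prod>m=Suc a..b. J m) * J (Suc b)"
        using m by (intro mult_le_mono1) simp
      finally have m': "multi_index (?J b) js * J (Suc b) + j < (\<Prod>m=Suc a..b. J m) * J (Suc b)" .
      have "entry (?T (Suc b)) (r # ks @ [s]) =
          (\<Sum>t<R b. entry (?T b) (r # js @ [t]) * entry (tt_core (X (Suc b))) [t, j, s])"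
        unfolding T using d len by (simp add: tensor_contract_def Let_def ks(1) del: upt_Suc)
      also have "\<dots> = (\<Sum>t<R b. tt_segment X a b $$ (r, t) $$ (multi_index (?J b) js, 0) *
          X (Suc b) $$ (t, s) $$ (j, 0))"
        using e r ks by (intro sum.cong) (auto simp: tt_core_def simp del: upt_Suc)
      also have "\<dots> = tt_segment X a (Suc b) $$ (r, s) $$ (multi_index (?J b) js * J (Suc b) + j, 0)"
        using strong_kron_index[OF c blocks_Suc[of b], of r s "multi_index (?J b) js * J (Suc b) + j" 0]
          r s b m' ks(3) rank_pos by (simp add: tt_segment_Suc del: upt_Suc)
      finally show "entry (?T (Suc b)) (r # ks @ [s]) =
          tt_segment X a (Suc b) $$ (r, s) $$ (multi_index (?J (Suc b)) ks, 0)"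
        unfolding J ks(1) multi_index_snoc[OF len] .
    qed
  qed
  then show "dims (?T b) = R a # ?J b @ [R b]"
    and "\<And>r js s. r < R a \<Longrightarrow> js \<in> index_set (?J b) \<Longrightarrow> s < R b \<Longrightarrow>
      entry (?T b) (r # js @ [s]) = tt_segment X a b $$ (r, s) $$ (multi_index (?J b) js, 0)"
    by auto
qed

text \<open>Here \<open>a\<close> is \<open>n - 1\<close>, and mode \<open>Suc a\<close> is the last
  mode of the left interface, its rank mode. The dropped first mode has size \<open>R 0 = 1\<close>,
  hence block row 0.\<close>

lemma matricize_tt_left:
  assumes "a < N"
  shows "matricize (Suc a) (tt_left X (Suc a)) =
    mat (R a) (\<Prod>m=Suc 0..a. J m) (\<lambda>(r, k). tt_segment X 0 a $$ (0, r) $$ (k, 0))"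
proof (cases "a = 0")
  case True
  then show ?thesis
    \<comment> \<open>For the empty left part both sides are the 1-by-1 matrix with entry 1.\<close>
    using boundary by (intro eq_matI) (auto simp: matricize_def tt_left_def tt_segment_def unit_block_def Let_def)
next
  case False
  let ?ds = "map J [Suc 0..<Suc a]"
  let ?T = "tt_left X (Suc a)"
  have T: "?T = drop_first_mode (chain tensor_contract (map (\<lambda>m. tt_core (X m)) [Suc 0..<Suc a]))"
    using False by (simp add: tt_left_def)
  have d: "dims ?T = ?ds @ [R a]"
    unfolding T using dims_chain_tt_core[of 0 a] False assms by (simp add: drop_first_mode_def del: upt_Suc)
  have "entry ?T (take a (multi_index_inv ?ds k) @ [r] @ drop a (multi_index_inv ?ds k)) =
      tt_segment X 0 a $$ (0, r) $$ (k, 0)" if "r < R a" "k < prod_list ?ds" for r k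
  proof -
    note js = multi_index_inv_in_index_set[OF that(2)]
    have "length (multi_index_inv ?ds k) = a"
      using index_set_length[OF js] by simp
    then show ?thesis
      unfolding T using entry_chain_tt_core[of 0 a 0 "multi_index_inv ?ds k" r] js that False assms boundary
      by (simp add: drop_first_mode_def multi_index_multi_index_inv del: upt_Suc)
  qed
  then show ?thesis
    unfolding prod_list_map_upt[symmetric]
    by (intro eq_matI) (auto simp: matricize_def d nth_append Let_def simp del: upt_Suc)
qed

lemma matricize_tt_right:
  assumes "n \<le> N"
  shows "matricize 1 (tt_right N X n) =
    mat (R n) (\<Prod>m=Suc n..N. J m) (\<lambda>(r, k). tt_segment X n N $$ (r, 0) $$ (k, 0))"
proof (cases "n = N")
  case True
  then show ?thesis
    using boundary by (intro eq_matI) (auto simp: matricize_def tt_right_def tt_segment_def unit_block_def Let_def)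
next
  case False
  let ?ds = "map J [Suc n..<Suc N]"
  let ?T = "tt_right N X n"
  have T: "?T = drop_last_mode (chain tensor_contract (map (\<lambda>m. tt_core (X m)) [Suc n..<Suc N]))"
    using False by (simp add: tt_right_def)
  have d: "dims ?T = R n # ?ds"
    unfolding T using dims_chain_tt_core[of n N] False assms by (simp add: drop_last_mode_def del: upt_Suc)
  have "entry ?T (r # multi_index_inv ?ds k) =
      tt_segment X n N $$ (r, 0) $$ (k, 0)" if "r < R n" "k < prod_list ?ds" for r k
    unfolding T using entry_chain_tt_core[of n N r "multi_index_inv ?ds k" 0]
      multi_index_inv_in_index_set[OF that(2)] that False assms boundary
    by (simp add: drop_last_mode_def multi_index_multi_index_inv del: upt_Suc)
  then show ?thesis
    unfolding prod_list_map_upt[symmetric]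
    by (intro eq_matI) (auto simp: matricize_def d Let_def simp del: upt_Suc)
qed

lemma prod_dims_split:
  assumes "a < N"
  shows "(\<Prod>m=1..N. J m) = (\<Prod>m=Suc 0..a. J m) * J (Suc a) * (\<Prod>m=Suc (Suc a)..N. J m)"
  using prod.ub_add_nat[of 1 "Suc a" J "N - Suc a"] assms by simp

text \<open>The row index has digits for the modes left of \<open>n\<close>, for mode
  \<open>n\<close> and for those right of it; the column index has digits for the left rank, mode
  \<open>n\<close> and the right rank. The identity factor gives the Kronecker delta between the two
  mode-\<open>n\<close> digits.\<close>

lemma
  assumes a: "a < N"
  shows frame_matrix_carrier: "frame_matrix N X (Suc a) \<in>
      carrier_mat (\<Prod>m=1..N. J m) (R a * J (Suc a) * R (Suc a))"
    and frame_matrix_index: "\<And>i k. i < (\<Prod>m=1..N. J m) \<Longrightarrow> k < R a * J (Suc a) * R (Suc a) \<Longrightarrow>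
      frame_matrix N X (Suc a) $$ (i, k) =
        (let n = Suc a; P = \<Prod>m=Suc n..N. J m; i' = i div P; k' = k div R n
         in tt_segment X 0 a $$ (0, k' div J n) $$ (i' div J n, 0) *
            (if i' mod J n = k' mod J n then 1 else 0) *
            tt_segment X n N $$ (k mod R n, 0) $$ (i mod P, 0))"
proof -
  let ?n = "Suc a" and ?P = "\<Prod>m=Suc (Suc a)..N. J m"
  have rows: "block_rows (X ?n) = J ?n"
    using block_carrierD(4)[OF blocks_Suc[OF a]] rank_pos a by simp
  note left = matricize_tt_left[OF a] and right = matricize_tt_right[OF Suc_leI[OF a]]
  show "frame_matrix N X ?n \<in> carrier_mat (\<Prod>m=1..N. J m) (R a * J ?n * R ?n)"
    by (simp add: frame_matrix_def kron_def left right rows prod_dims_split[OF a] del: One_nat_def)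
  fix i k
  assume i: "i < (\<Prod>m=1..N. J m)" and k: "k < R a * J ?n * R ?n"
  \<comment> \<open>A factor 0 would leave no valid \<open>i\<close> or \<open>k\<close>.\<close>
  have "0 < ?P" "0 < J ?n" "0 < R ?n"
    using i k unfolding prod_dims_split[OF a] by (metis gr0I mult_0 mult_0_right not_less_zero)+
  moreover from this have "i div ?P < (\<Prod>m=Suc 0..a. J m) * J ?n" "k div R ?n < R a * J ?n"
    using i k unfolding prod_dims_split[OF a] by (auto simp: less_mult_imp_div_less)
  moreover from this have "i div ?P div J ?n < (\<Prod>m=Suc 0..a. J m)" "k div R ?n div J ?n < R a"
    by (auto simp: less_mult_imp_div_less)
  ultimately show "frame_matrix N X ?n $$ (i, k) =
      (let n = ?n; P = \<Prod>m=Suc n..N. J m; i' = i div P; k' = k div R n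
       in tt_segment X 0 a $$ (0, k' div J n) $$ (i' div J n, 0) *
          (if i' mod J n = k' mod J n then 1 else 0) *
          tt_segment X n N $$ (k mod R n, 0) $$ (i mod P, 0))"
    using i k unfolding prod_dims_split[OF a]
    by (simp add: frame_matrix_def kron_def left right rows Let_def del: One_nat_def)
qed

lemma tt_vector_update:
  assumes "a < N" and "B \<in> block_carrier (R a) (R (Suc a)) (J (Suc a)) 1"
  shows "tt_vector N R J (X(Suc a := B))"
  using assms blocks rank_pos boundary by unfold_locales auto

text \<open>The delta collapses the sum over the mode-\<open>n\<close> digit of \<open>w\<close>.
  The sums over the two rank digits that remain are exactly those of the strong Kronecker products
  on either side of the fiber blocks.\<close>

lemma frame_matrix_mult_vec:
  assumes a: "a < N" and W: "dims W = [R a, J (Suc a), R (Suc a)]"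
  shows "col_mat (frame_matrix N X (Suc a) *\<^sub>v vec_tensor W) =
    tt_product N (X(Suc a := fiber_blocks W))"
proof -
  let ?n = "Suc a" and ?P = "\<Prod>m=Suc (Suc a)..N. J m" and ?Y = "fiber_blocks W"
  let ?F = "frame_matrix N X ?n"
  note Y = fiber_blocks_carrier[OF W] and F = frame_matrix_carrier[OF a]
  interpret X': tt_vector N R J "X(?n := ?Y)"
    by (rule tt_vector_update[OF a Y])
  have L: "tt_segment X 0 a \<in> block_carrier 1 (R a) (\<Prod>m=Suc 0..a. J m) 1"
    and T: "tt_segment X ?n N \<in> block_carrier (R ?n) 1 ?P 1"
    using tt_vector_segment_carrier[of 0 a] tt_vector_segment_carrier[of ?n N] boundary a by auto
  note LY = strong_kron_carrier[OF L Y] and LYi = strong_kron_index[OF L Y]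
  have "tt_product N (X(?n := ?Y)) = tt_segment (X(?n := ?Y)) 0 N $$ (0, 0)"
    using X'.tt_product_eq a boundary by simp
  \<comment> \<open>Split before and after the replaced core; an outer segment is empty only at a
    boundary, where the rank is 1.\<close>
  also have "tt_segment (X(?n := ?Y)) 0 N =
      strong_kron (strong_kron (tt_segment (X(?n := ?Y)) 0 a) (tt_segment (X(?n := ?Y)) a ?n))
        (tt_segment (X(?n := ?Y)) ?n N)"
    using X'.tt_segment_append[of 0 ?n N] X'.tt_segment_append[of 0 a ?n] a boundary by simp
  \<comment> \<open>Neither outer segment contains the replaced core.\<close>
  also have "\<dots> = strong_kron (strong_kron (tt_segment X 0 a) ?Y) (tt_segment X ?n N)"
    using tt_segment_cong[of 0 a "X(?n := ?Y)" X] tt_segment_cong[of ?n N "X(?n := ?Y)" X]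
    by (simp add: tt_segment_single)
  finally have tt: "tt_product N (X(?n := ?Y)) =
    strong_kron (strong_kron (tt_segment X 0 a) ?Y) (tt_segment X ?n N) $$ (0, 0)" .
  have pos: "0 < R a" "0 < R ?n"
    using rank_pos a by auto
  have LY1: "strong_kron (tt_segment X 0 a) ?Y \<in>
      block_carrier 1 (R ?n) ((\<Prod>m=Suc 0..a. J m) * J ?n) 1"
    using LY pos by simp
  have tt_carrier: "tt_product N (X(?n := ?Y)) \<in> carrier_mat (\<Prod>m=1..N. J m) 1"
    using block_carrierD(3)[OF strong_kron_carrier[OF LY1 T], of 0 0] pos
    unfolding tt prod_dims_split[OF a] by simp
  show ?thesis
  proof (rule eq_matI)
    fix i j
    assume "i < dim_row (tt_product N (X(?n := ?Y)))" "j < dim_col (tt_product N (X(?n := ?Y)))"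
    then have i: "i < (\<Prod>m=1..N. J m)" and j: "j = 0"
      using tt_carrier by auto
    let ?i = "i div ?P"
    have P: "0 < ?P" "0 < J ?n"
      using i unfolding prod_dims_split[OF a] by (metis gr0I mult_0 mult_0_right not_less_zero)+
    have i': "?i < (\<Prod>m=Suc 0..a. J m) * J ?n"
      using i unfolding prod_dims_split[OF a] by (simp add: less_mult_imp_div_less)
    let ?l = "\<lambda>r. tt_segment X 0 a $$ (0, r) $$ (?i div J ?n, 0)"
    let ?t = "\<lambda>s. tt_segment X ?n N $$ (s, 0) $$ (i mod ?P, 0)"
    let ?d = "\<lambda>q. if ?i mod J ?n = q then 1 else 0 :: real"
    have "col_mat (?F *\<^sub>v vec_tensor W) $$ (i, j) =
        (\<Sum>k<R a * J ?n * R ?n. ?F $$ (i, k) * vec_tensor W $ k)"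
      using F i by (auto simp: col_mat_def j mat_of_cols_def scalar_prod_def lessThan_atLeast0
          vec_tensor_def W mult.assoc intro!: sum.cong)
    also have "\<dots> = (\<Sum>k<R a * J ?n * R ?n. ?l (k div R ?n div J ?n) * ?d (k div R ?n mod J ?n) *
        ?t (k mod R ?n) * entry W [k div R ?n div J ?n, k div R ?n mod J ?n, k mod R ?n])"
      using i by (intro sum.cong refl) (simp add: frame_matrix_index[OF a] vec_tensor_index3[OF W] Let_def)
    \<comment> \<open>The column index is unpacked from the right: first the digit \<open>s\<close>
      is split off, then \<open>p\<close> into \<open>r\<close> and \<open>q\<close>.\<close>
    also have "\<dots> = (\<Sum>p<R a * J ?n. \<Sum>s<R ?n.
        ?l (p div J ?n) * ?d (p mod J ?n) * ?t s * entry W [p div J ?n, p mod J ?n, s])"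
      by (rule sum_lessThan_mult)
    also have "\<dots> = (\<Sum>r<R a. \<Sum>q<J ?n. \<Sum>s<R ?n. ?l r * ?d q * ?t s * entry W [r, q, s])"
      by (rule sum_lessThan_mult)
    also have "\<dots> = (\<Sum>r<R a. \<Sum>q<J ?n. if ?i mod J ?n = q
        then \<Sum>s<R ?n. ?l r * ?t s * entry W [r, q, s] else 0)"
      by (intro sum.cong refl) auto
    also have "\<dots> = (\<Sum>r<R a. \<Sum>s<R ?n. ?l r * ?t s * entry W [r, ?i mod J ?n, s])"
      using P by simp
    also have "\<dots> = (\<Sum>s<R ?n. (\<Sum>r<R a. ?l r * entry W [r, ?i mod J ?n, s]) * ?t s)"
      unfolding sum_distrib_right by (subst sum.swap) (simp add: ac_simps)
    also have "\<dots> = (\<Sum>s<R ?n. (\<Sum>r<R a. ?l r * ?Y $$ (r, s) $$ (?i mod J ?n, 0)) * ?t s)"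
      using P by (simp add: fiber_blocks_def W col_mat_def mat_of_cols_def)
    also have "\<dots> = tt_product N (X(?n := ?Y)) $$ (i, j)"
      using strong_kron_index[OF LY1 T, of 0 0 i 0] i i' pos
      unfolding tt j prod_dims_split[OF a] by (simp add: LYi)
    finally show "col_mat (?F *\<^sub>v vec_tensor W) $$ (i, j) = tt_product N (X(?n := ?Y)) $$ (i, j)" .
  qed (use tt_carrier F in \<open>auto simp: col_mat_def\<close>)
qed

end

section \<open>Applying the matrix TT to the product of frame matrix and vector\<close>

lemma mult_col_mat:
  assumes "A \<in> carrier_mat n m" "v \<in> carrier_vec m"
  shows "A * col_mat v = col_mat (A *\<^sub>v v)"
  using assms by (intro eq_matI) (auto simp: col_mat_def mat_of_cols_def scalar_prod_def)

theorem proposition4p1: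
  fixes N n :: nat and I J R RA :: "nat \<Rightarrow> nat"
    and X A Z :: "nat \<Rightarrow> block_matrix"
    and x w :: "real vec" and M An :: "real mat" and W :: tensor
  assumes n: "n \<in> {1..N}"
    and ranks_pos: "\<And>m. m \<le> N \<Longrightarrow> 0 < R m" "\<And>m. m \<le> N \<Longrightarrow> 0 < RA m"
    and boundary: "R 0 = 1" "R N = 1" "RA 0 = 1" "RA N = 1"
    and x_dim: "x \<in> carrier_vec (\<Prod>m=1..N. J m)"
    and M_dim: "M \<in> carrier_mat (\<Prod>m=1..N. I m) (\<Prod>m=1..N. J m)"
    and X_blocks: "\<And>m. m \<in> {1..N} \<Longrightarrow> X m \<in> block_carrier (R (m - 1)) (R m) (J m) 1"
    and A_blocks: "\<And>m. m \<in> {1..N} \<Longrightarrow> A m \<in> block_carrier (RA (m - 1)) (RA m) (I m) (J m)"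
    and x_TT: "col_mat x = tt_product N X"
    and M_TT: "M = tt_product N A"
    and An_def: "An = M * frame_matrix N X n"
    and w_dim: "w \<in> carrier_vec (R (n - 1) * J n * R n)"
    and W_dims: "dims W = [R (n - 1), J n, R n]"
    and w_vec: "w = vec_tensor W"
    and Z_def: "\<And>m. m \<in> {1..N} - {n} \<Longrightarrow> Z m = contracted_product (A m) (X m)"
    and Zn_def: "Z n = contracted_product (A n) (fiber_blocks W)"
  shows "frame_matrix N X n \<in> carrier_mat (\<Prod>m=1..N. J m) (R (n - 1) * J n * R n)
    \<and> An \<in> carrier_mat (\<Prod>m=1..N. I m) (R (n - 1) * J n * R n)
    \<and> (\<forall>m\<in>{1..N}. Z m \<in> block_carrier (RA (m - 1) * R (m - 1)) (RA m * R m) (I m) 1)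
    \<and> col_mat (An *\<^sub>v w) = tt_product N Z"
proof -
  obtain a where na: "n = Suc a" and a: "a < N"
    using n by (cases n) auto
  interpret A: tt_blocks N RA I J A
    using ranks_pos(2) A_blocks by unfold_locales
  interpret X: tt_vector N R J X
    using ranks_pos(1) X_blocks boundary(1,2) by unfold_locales
  \<comment> \<open>With the fibers of \<open>W\<close> as core \<open>n\<close>, every
    \<open>Z m\<close> is a contracted product of \<open>A m\<close> and \<open>Y m\<close>, without
    a special case.\<close>
  define Y where "Y = X(n := fiber_blocks W)"
  have Yn: "fiber_blocks W \<in> block_carrier (R a) (R (Suc a)) (J (Suc a)) 1"
    using fiber_blocks_carrier[OF W_dims] by (simp add: na)
  interpret Y: tt_vector N R J Y
    unfolding Y_def na by (rule X.tt_vector_update[OF a Yn])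
  have Z: "Z m = contracted_product (A m) (Y m)" if "m \<in> {1..N}" for m
    using that Z_def Zn_def by (cases "m = n") (auto simp: Y_def)
  have F: "frame_matrix N X n \<in> carrier_mat (\<Prod>m=1..N. J m) (R (n - 1) * J n * R n)"
    using X.frame_matrix_carrier[OF a] by (simp add: na)
  have An: "An \<in> carrier_mat (\<Prod>m=1..N. I m) (R (n - 1) * J n * R n)"
    unfolding An_def using M_dim F by (rule mult_carrier_mat)
  have Z_blocks: "Z m \<in> block_carrier (RA (m - 1) * R (m - 1)) (RA m * R m) (I m) 1" if "m \<in> {1..N}" for m
    unfolding Z[OF that] using A.blocks[OF that] Y.blocks[OF that] by (rule contracted_product_carrier)
  \<comment> \<open>Applying the frame matrix to \<open>w\<close> first yields a vector TT, so only
    a product of two TT products is left.\<close>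
  have "An *\<^sub>v w = M *\<^sub>v (frame_matrix N X n *\<^sub>v w)"
    unfolding An_def using M_dim F w_dim by (rule assoc_mult_mat_vec)
  then have "col_mat (An *\<^sub>v w) = M * col_mat (frame_matrix N X n *\<^sub>v w)"
    using mult_col_mat[OF M_dim mult_mat_vec_carrier[OF F w_dim]] by simp
  also have "\<dots> = tt_product N A * tt_product N Y"
    using X.frame_matrix_mult_vec[OF a] W_dims by (simp add: M_TT w_vec Y_def na)
  also have "\<dots> = tt_product N (\<lambda>m. contracted_product (A m) (Y m))"
    using tt_product_contracted_product[OF A.tt_blocks_axioms Y.tt_blocks_axioms] boundary a by simp
  also have "\<dots> = tt_product N Z"
    \<comment> \<open>The TT product depends only on the factors 1 to \<open>N\<close>, the range on
      which \<open>Z\<close> is known.\<close>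
    unfolding tt_product_def using Z by (intro arg_cong[of _ _ "\<lambda>xs. unblock (chain strong_kron xs)"] map_cong) auto
  finally show ?thesis
    using F An Z_blocks by blast
qed

end
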